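(* For every integer $k\ge 2$ with $k \neq 3$, we have $E_k(n)=2n-3$ for all integers $n \geq 3$; and $E_3(n)=2n-4$ for all integers $n \geq 4$.
   Context: Let $k\ge 1$ be an integer. For a point $p\in\mathbb{R}^2$ and $i=0,\dots,k-1$, let $\ell_i(p)$ be the ray from $p$ in direction $(\cos(2\pi i/k),\sin(2\pi i/k))$. These $k$ rays (the sector-bounding rays of $p$) divide the plane around $p$ into $k$ equal sectors $s_0(p),\dots,s_{k-1}(p)$, where $s_i(p)$ is the sector bounded by $\ell_i(p)$ and the next ray $\ell_{i+1}(p)$ counterclockwise (indices mod $k$). All point sets are finite and in general position (with respect to $k$): no point of the set lies on a sector-bounding ray of another point of the set, and there are no three distinct points $p,q,q'$ in the set such that $q,q'$ lie in the same sector of $p$ and are at the same Euclidean distance from $p$. Given a point set $P$ and a linear order $p_1,\dots,p_n$ of $P$, the corresponding $k$-sector ordered Yao graph is the directed graph on $P$ in which, for every $j$ and every $i$ such that the sector $s_i(p_j)$ contains at least one of the predecessors $p_1,\dots,p_{j-1}$, there is exactly one edge from $p_j$ to its closest (in Euclidean distance) predecessor in $s_i(p_j)$; there are no other edges. $E_k(n)$ is the maximum integer such that for every $n$-point set in the plane there exists an order for which the corresponding $k$-sector ordered Yao graph contains at least $E_k(n)$ edges. *)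

theory Defs
  imports "HOL-Analysis.Analysis"
begin

definition unit_dir :: "real \<Rightarrow> real ^ 2" where
  "unit_dir t = vector [cos t, sin t]"

definition bounding_ray :: "nat \<Rightarrow> nat \<Rightarrow> real ^ 2 \<Rightarrow> (real ^ 2) set" where
  "bounding_ray k i p = {p + r *\<^sub>R unit_dir (2 * pi * real i / real k) | r. r \<ge> 0}"

(* The sectors are taken to be open. Whether a sector contains its bounding rays is
   irrelevant for point sets in general position. For i = k - 1 the upper bounding angle is
   2 * pi, i.e. the next ray is the one with index 0. *)
definition sector :: "nat \<Rightarrow> nat \<Rightarrow> real ^ 2 \<Rightarrow> (real ^ 2) set" where
  "sector k i p =
     {p + r *\<^sub>R unit_dir t | r t.
        r > 0 \<and> 2 * pi * real i / real k < t \<and> t < 2 * pi * real (Suc i) / real k}"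

definition general_position :: "nat \<Rightarrow> (real ^ 2) set \<Rightarrow> bool" where
  "general_position k P \<longleftrightarrow>
     (\<forall>p\<in>P. \<forall>q\<in>P. q \<noteq> p \<longrightarrow> (\<forall>i<k. q \<notin> bounding_ray k i p)) \<and>
     (\<forall>p\<in>P. \<forall>q\<in>P. \<forall>q'\<in>P. p \<noteq> q \<and> p \<noteq> q' \<and> q \<noteq> q' \<longrightarrow>
        (\<forall>i<k. q \<in> sector k i p \<and> q' \<in> sector k i p \<longrightarrow> dist p q \<noteq> dist p q'))"

(* A linear order of a finite point set is the list of its points without repetition.
   The predecessors of ps ! j are the elements of take j ps. In general position the closest
   predecessor in a sector is unique, and different sectors of a point are disjoint, so this
   set has exactly one edge per point and sector that contains a predecessor. *)
definition ordered_yao_edges :: "nat \<Rightarrow> (real ^ 2) list \<Rightarrow> ((real ^ 2) \<times> (real ^ 2)) set" where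
  "ordered_yao_edges k ps =
     {(ps ! j, q) | j q. j < length ps \<and>
        (\<exists>i<k. is_arg_min (dist (ps ! j)) (\<lambda>x. x \<in> set (take j ps) \<inter> sector k i (ps ! j)) q)}"

definition max_yao_edges :: "nat \<Rightarrow> nat \<Rightarrow> int" where
  "max_yao_edges k n =
     (GREATEST m. \<forall>P. finite P \<and> card P = n \<and> general_position k P \<longrightarrow>
        (\<exists>ps. distinct ps \<and> set ps = P \<and> m \<le> int (card (ordered_yao_edges k ps))))"

end

theory Submission imports Defs begin

text \<open>
  In general position a point \<open>p\<close> of an order contributes exactly as many edges as there are
  sectors of \<open>p\<close> that contain predecessors of \<open>p\<close>. So the edge number of an order is the sum, over
  its points, of the number of sectors that each point sees among its predecessors
  (\<open>card_ordered_yao_edges_snoc\<close>), and everything reduces to counting seen sectors.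

  \<^bold>\<open>Many edges.\<close> If some point of the current set sees at least two sectors among the other points,
  it can be put last, where it contributes at least two edges; the remaining points are ordered in the
  same way (\<open>order_with_many_edges\<close>). When does such a point fail to exist? Then every point \<open>p\<close> sees
  all others in one sector \<open>f p\<close>. Two points see each other in opposite directions, and opposite
  directions have sector indices that differ by about \<open>k/2\<close>: twice the difference is within 1 of
  \<open>k\<close> (\<open>opposite_sectors\<close>). Three numbers can differ pairwise by about \<open>k/2\<close> within that tolerance
  only if \<open>k = 3\<close>, and for \<open>k = 3\<close> the indices \<open>f p\<close> are pairwise distinct elements of \<open>{0, 1, 2}\<close>, so
  four points are impossible (\<open>two_sector_point_exists\<close>). Hence each point can contribute
  two edges except for the first two points (\<open>1\<close> edge together) if \<open>k \<noteq> 3\<close>, and except for the first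
  three points (at least \<open>2\<close> edges together) if \<open>k = 3\<close>. This gives \<open>2n - 3\<close> and \<open>2n - 4\<close>.

  \<^bold>\<open>Few edges.\<close> Suppose that every point of a set sees at most two sectors, and that \<open>s\<close> of its points
  see at most one. Compared to two edges per point, the first point of an order loses two, the second
  loses one, and each later one-sector point loses one, so at least \<open>3 + (s - 2)\<close> edges are lost
  (\<open>edges_bound_by_one_sector_points\<close>). Points on a generic line have \<open>s = 2\<close>, namely the two extreme
  points (\<open>line_witness\<close>). For \<open>k = 3\<close> the line can be complemented by one apex such that the apex and
  the two extreme points form a triangle whose corners look inwards into the three different sectors;
  then \<open>s = 3\<close> (\<open>triangle_witness\<close>).
\<close>

section \<open>Angles and sectors\<close>

lemma unit_dir_nth [simp]: "unit_dir t $ 1 = cos t" "unit_dir t $ 2 = sin t"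
  by (simp_all add: unit_dir_def)

lemma norm_unit_dir [simp]: "norm (unit_dir t) = 1"
  by (simp add: norm_eq_sqrt_inner inner_vec_def sum_2 flip: power2_eq_square)

lemma unit_dir_plus_pi: "unit_dir (t + pi) = - unit_dir t"
  by (simp add: vec_eq_iff forall_2)

lemma polar_form:
  fixes v :: "real ^ 2"
  assumes "v \<noteq> 0"
  obtains r t where "r > 0" "0 \<le> t" "t < 2 * pi" "v = r *\<^sub>R unit_dir t"
proof -
  have "norm v ^ 2 = (v $ 1)^2 + (v $ 2)^2"
    by (simp add: power2_norm_eq_inner inner_vec_def sum_2 flip: power2_eq_square)
  then have "(v $ 1 / norm v)^2 + (v $ 2 / norm v)^2 = 1"
    using assms by (metis add_divide_distrib divide_self norm_eq_zero power_divide power_eq_0_iff)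
  then obtain t where t: "0 \<le> t" "t < 2 * pi" "v $ 1 / norm v = cos t" "v $ 2 / norm v = sin t"
    using sincos_total_2pi by metis
  have "v = norm v *\<^sub>R unit_dir t"
    using assms by (simp add: vec_eq_iff forall_2 flip: t(3,4))
  with t assms show thesis
    using that[of "norm v" t] by simp
qed

lemma polar_form_unique:
  assumes "r *\<^sub>R unit_dir t = s *\<^sub>R unit_dir u" "r > 0" "s \<ge> 0"
  obtains n :: int where "t = u + 2 * pi * n" "r = s"
proof -
  have "norm (r *\<^sub>R unit_dir t) = norm (s *\<^sub>R unit_dir u)"
    by (simp only: assms(1))
  then have "r = s" using assms(2,3) by simp
  with assms have "unit_dir t = unit_dir u" by simp
  then have "sin t = sin u \<and> cos t = cos u"
    by (metis unit_dir_nth)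
  then obtain n :: int where "t = u + 2 * pi * n"
    using sin_cos_eq_iff[of t u] by auto
  with \<open>r = s\<close> that show thesis by blast
qed

lemma polar_angle_unique:
  assumes "r *\<^sub>R unit_dir t = s *\<^sub>R unit_dir u" "r > 0" "s \<ge> 0" "\<bar>t - u\<bar> < 2 * pi"
  shows "t = u"
proof -
  obtain n :: int where n: "t = u + 2 * pi * n"
    using polar_form_unique assms(1-3) by metis
  then have "\<bar>2 * pi * n\<bar> < 2 * pi" using assms(4) by simp
  then have "\<bar>real_of_int n\<bar> < 1" by (simp add: abs_mult)
  then have "n = 0" by linarith
  with n show ?thesis by simp
qed

text \<open>
  Angles are measured in units of \<open>2 * pi / k\<close> here, so that a direction \<open>t\<close> lies in the sector with
  index \<open>i\<close> iff \<open>i\<close> is the integer part of the non-integer \<open>t\<close>.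
\<close>

lemma sectorE:
  assumes "q \<in> sector k i p"
  obtains r t where "q = p + r *\<^sub>R unit_dir (2 * pi * t / k)" "r > 0" "real i < t" "t < real i + 1"
proof -
  from assms obtain r t where *: "q = p + r *\<^sub>R unit_dir t" "r > 0"
    "2 * pi * real i / real k < t" "t < 2 * pi * real (Suc i) / real k"
    unfolding sector_def by blast
  have k: "k > 0" using *(3,4) by (cases k) auto
  show thesis
  proof (rule that[of r "t * k / (2 * pi)"])
    show "q = p + r *\<^sub>R unit_dir (2 * pi * (t * real k / (2 * pi)) / real k)" "r > 0"
      using * k by simp_all
    show "real i < t * real k / (2 * pi)" "t * real k / (2 * pi) < real i + 1"
      using *(3,4) k by (simp_all add: field_simps)
  qed
qed

lemma sectorI:
  assumes "q = p + r *\<^sub>R unit_dir (2 * pi * t / k)" "r > 0" "real i < t" "t < real i + 1" "k > 0"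
  shows "q \<in> sector k i p"
  unfolding sector_def using assms
  by (intro CollectI exI[of _ r] exI[of _ "2 * pi * t / k"]) (auto simp: divide_strict_right_mono)

lemma same_direction_index:
  fixes k :: nat
  assumes "r *\<^sub>R unit_dir (2 * pi * t / k) = s *\<^sub>R unit_dir (2 * pi * u / k)" "r > 0" "s \<ge> 0"
    "0 \<le> t" "t < k" "0 \<le> u" "u < k"
  shows "t = u"
proof -
  have k: "k > 0" using assms by linarith
  have "\<bar>2 * pi * t / k - 2 * pi * u / k\<bar> = 2 * pi * (\<bar>t - u\<bar> / k)"
    by (simp add: abs_mult flip: diff_divide_distrib right_diff_distrib)
  also have "\<dots> < 2 * pi * 1"
    using assms k by (intro mult_strict_left_mono) auto
  finally have "2 * pi * t / k = 2 * pi * u / k"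
    using polar_angle_unique[OF assms(1-3)] by simp
  then show ?thesis using k by simp
qed

lemma sector_index_unique:
  assumes "q \<in> sector k i p" "q \<in> sector k j p" "i < k" "j < k"
  shows "i = j"
proof -
  obtain r t where 1: "q = p + r *\<^sub>R unit_dir (2 * pi * t / k)" "r > 0" "real i < t" "t < real i + 1"
    using assms(1) by (rule sectorE)
  obtain s u where 2: "q = p + s *\<^sub>R unit_dir (2 * pi * u / k)" "s > 0" "real j < u" "u < real j + 1"
    using assms(2) by (rule sectorE)
  have "t = u"
    using same_direction_index[of r t k s u] 1 2 assms(3,4) by auto
  then show ?thesis using 1 2 by linarith
qed

lemma sector_disjoint_bounding_ray:
  assumes "q \<in> sector k i p" "i < k" "j < k"
  shows "q \<notin> bounding_ray k j p"
proof
  assume "q \<in> bounding_ray k j p"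
  then obtain s where 2: "q = p + s *\<^sub>R unit_dir (2 * pi * real j / k)" "s \<ge> 0"
    unfolding bounding_ray_def by auto
  obtain r t where 1: "q = p + r *\<^sub>R unit_dir (2 * pi * t / k)" "r > 0" "real i < t" "t < real i + 1"
    using assms(1) by (rule sectorE)
  have "t = real j"
    using same_direction_index[of r t k s "real j"] 1 2 assms by auto
  with 1 have "i < j" "j < i + 1" by linarith+
  then show False by simp
qed

lemma in_some_sector:
  assumes "q \<noteq> p" "k > 0" "\<And>i. i < k \<Longrightarrow> q \<notin> bounding_ray k i p"
  obtains i where "i < k" "q \<in> sector k i p"
proof -
  obtain r t where rt: "r > 0" "0 \<le> t" "t < 2 * pi" "q - p = r *\<^sub>R unit_dir t"
    using polar_form[of "q - p"] assms(1) by auto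
  define u where "u = t * k / (2 * pi)"
  have t: "t = 2 * pi * u / k" using assms(2) by (simp add: u_def)
  have u: "0 \<le> u" "u < k" using rt assms(2) by (simp_all add: u_def field_simps)
  define i where "i = nat \<lfloor>u\<rfloor>"
  have i: "real i \<le> u" "u < real i + 1" using u by (simp_all add: i_def)
  then have "i < k" using u by linarith
  have q: "q = p + r *\<^sub>R unit_dir (2 * pi * u / k)"
    using rt(4) t by (simp add: algebra_simps)
  have "u \<noteq> real i"
    using assms(3)[OF \<open>i < k\<close>] q rt(1) unfolding bounding_ray_def by auto
  with i have "real i < u" by simp
  then have "q \<in> sector k i p"
    using sectorI[OF q rt(1) _ i(2) assms(2)] by simp
  with \<open>i < k\<close> that show thesis by blast
qed

text \<open>
  Reversing a direction adds \<open>k/2\<close> to it modulo \<open>k\<close>, in units of one sector, and taking integer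
  parts changes the difference of two directions by less than 1. A disjunction avoids nested absolute
  values.
\<close>

lemma opposite_sectors:
  assumes "q \<in> sector k i p" "p \<in> sector k j q" "i < k" "j < k"
  shows "2 * (int i - int j) \<in> {int k - 1..int k + 1} \<or> 2 * (int j - int i) \<in> {int k - 1..int k + 1}"
proof -
  obtain r t where 1: "q = p + r *\<^sub>R unit_dir (2 * pi * t / k)" "r > 0" "real i < t" "t < real i + 1"
    using assms(1) by (rule sectorE)
  obtain s u where 2: "p = q + s *\<^sub>R unit_dir (2 * pi * u / k)" "s > 0" "real j < u" "u < real j + 1"
    using assms(2) by (rule sectorE)
  have k: "k > 0" using assms by simp
  have "r *\<^sub>R unit_dir (2 * pi * t / k) = s *\<^sub>R unit_dir (2 * pi * u / k + pi)"
    using 1(1) 2(1) by (subst unit_dir_plus_pi) (metis add_diff_cancel_left' minus_diff_eq scaleR_minus_right)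
  then obtain n :: int where n: "2 * pi * t / k = 2 * pi * u / k + pi + 2 * pi * n"
    using polar_form_unique 1(2) 2(2) by (metis less_imp_le)
  then have "pi * (2 * t) = pi * (2 * u + k + 2 * k * n)"
    using k by (simp add: field_simps)
  then have n': "2 * t = 2 * u + k + 2 * (k * n)" by simp
  have "\<bar>t - u\<bar> < k" using 1 2 assms by linarith
  then have "k * real_of_int n < k * (1/2)" "k * (-3/2) < k * real_of_int n"
    using n' by simp_all
  then have "real_of_int n < 1/2" "-3/2 < real_of_int n"
    using k by (simp_all only: mult_less_cancel_left_pos of_nat_0_less_iff)
  then have "n = 0 \<or> n = -1" by linarith
  then have "2 * t = 2 * u + k \<or> 2 * t = 2 * u - k" using n' by auto
  then show ?thesis
  proof
    assume *: "2 * t = 2 * u + k"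
    have "2 * int i < 2 * int j + 2 + k" "2 * int j + k < 2 * int i + 2"
      using 1 2 * by linarith+
    then show ?thesis by simp
  next
    assume *: "2 * t = 2 * u - k"
    have "2 * int i + k < 2 * int j + 2" "2 * int j < 2 * int i + 2 + k"
      using 1 2 * by linarith+
    then show ?thesis by simp
  qed
qed

section \<open>Counting edges by the sectors that each point sees\<close>

definition seen_sectors :: "nat \<Rightarrow> real ^ 2 \<Rightarrow> (real ^ 2) set \<Rightarrow> nat set" where
  "seen_sectors k p A = {i. i < k \<and> A \<inter> sector k i p \<noteq> {}}"

definition yao_targets :: "nat \<Rightarrow> real ^ 2 \<Rightarrow> (real ^ 2) set \<Rightarrow> (real ^ 2) set" where
  "yao_targets k p A = {q. \<exists>i<k. is_arg_min (dist p) (\<lambda>x. x \<in> A \<inter> sector k i p) q}"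

lemma finite_seen_sectors [simp]: "finite (seen_sectors k p A)"
  by (simp add: seen_sectors_def)

lemma seen_sectors_mono: "A \<subseteq> B \<Longrightarrow> seen_sectors k p A \<subseteq> seen_sectors k p B"
  by (auto simp: seen_sectors_def)

lemma seen_sectors_empty [simp]: "seen_sectors k p {} = {}"
  by (simp add: seen_sectors_def)

lemma general_position_subset: "general_position k P \<Longrightarrow> Q \<subseteq> P \<Longrightarrow> general_position k Q"
  unfolding general_position_def by (meson subsetD)

text \<open>
  General position enters twice: distances within a sector do not tie, so there is only one nearest
  point per seen sector; and sectors are disjoint, so different sectors have different nearest points.
\<close>

lemma card_yao_targets:
  assumes "general_position k (insert p A)" "finite A" "p \<notin> A"
  shows "card (yao_targets k p A) = card (seen_sectors k p A)"
proof -
  let ?near = "\<lambda>i q. is_arg_min (dist p) (\<lambda>x. x \<in> A \<inter> sector k i p) q"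
  have ex: "\<exists>q. ?near i q" if "i \<in> seen_sectors k p A" for i
    using that assms(2) ex_is_arg_min_if_finite[of "A \<inter> sector k i p" "dist p"]
    unfolding seen_sectors_def by simp
  have in_sector: "q \<in> A \<inter> sector k i p" if "?near i q" for i q
    using that by (simp add: is_arg_min_def)
  have unique: "q = q'" if "?near i q" "?near i q'" "i < k" for i q q'
  proof (rule ccontr)
    assume "q \<noteq> q'"
    have m: "q \<in> A" "q \<in> sector k i p" "q' \<in> A" "q' \<in> sector k i p"
      using that(1,2)[THEN in_sector] by blast+
    have "dist p q = dist p q'"
      using that(1,2) m unfolding is_arg_min_def by (meson IntI linorder_neqE_linordered_idom)
    moreover have "p \<noteq> q" "p \<noteq> q'" using m assms(3) by auto
    moreover have "dist p q \<noteq> dist p q'" if "p \<noteq> q" "p \<noteq> q'"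
      using assms(1) m \<open>q \<noteq> q'\<close> \<open>i < k\<close> that unfolding general_position_def by blast
    ultimately show False by simp
  qed
  define f where "f i = (SOME q. ?near i q)" for i
  have f: "?near i (f i)" if "i \<in> seen_sectors k p A" for i
    unfolding f_def using ex[OF that] by (rule someI_ex)
  have "inj_on f (seen_sectors k p A)"
  proof (rule inj_onI)
    fix i j assume ij: "i \<in> seen_sectors k p A" "j \<in> seen_sectors k p A" "f i = f j"
    then show "i = j"
      using f[OF ij(1), THEN in_sector] f[OF ij(2), THEN in_sector] sector_index_unique[of "f i" k i p j]
      by (simp add: seen_sectors_def)
  qed
  moreover have "f ` seen_sectors k p A = yao_targets k p A"
  proof (intro set_eqI iffI)
    fix q assume "q \<in> f ` seen_sectors k p A"
    then obtain i where "i \<in> seen_sectors k p A" "q = f i" by blast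
    then show "q \<in> yao_targets k p A"
      using f[of i] unfolding yao_targets_def seen_sectors_def by blast
  next
    fix q assume "q \<in> yao_targets k p A"
    then obtain i where i: "i < k" "?near i q" by (auto simp: yao_targets_def)
    then have "i \<in> seen_sectors k p A"
      using in_sector[OF i(2)] unfolding seen_sectors_def by blast
    then show "q \<in> f ` seen_sectors k p A"
      using unique[OF i(2) f i(1)] by simp
  qed
  ultimately show ?thesis
    by (metis card_image)
qed

lemma ordered_yao_edges_Nil [simp]: "ordered_yao_edges k [] = {}"
  by (simp add: ordered_yao_edges_def)

lemma ordered_yao_edges_snoc:
  "ordered_yao_edges k (ps @ [p]) = ordered_yao_edges k ps \<union> {p} \<times> yao_targets k p (set ps)"
  (is "?L = ?A \<union> ?B")
proof -
  \<comment> \<open>The edges that start at earlier points are unaffected by the appended point.\<close>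
  have *: "(ps @ [p]) ! j = ps ! j \<and> take j (ps @ [p]) = take j ps" if "j < length ps" for j
    using that by (simp add: nth_append)
  show ?thesis
  proof (intro set_eqI iffI; simp only: split_paired_all)
    fix a b assume "(a, b) \<in> ?L"
    then obtain j i where j: "j \<le> length ps" "a = (ps @ [p]) ! j" "i < k"
      "is_arg_min (dist a) (\<lambda>x. x \<in> set (take j (ps @ [p])) \<inter> sector k i a) b"
      unfolding ordered_yao_edges_def by (auto simp: less_Suc_eq_le)
    show "(a, b) \<in> ?A \<union> ?B"
    proof (cases "j = length ps")
      case True
      then show ?thesis using j by (auto simp: yao_targets_def)
    next
      case False
      then show ?thesis using j * unfolding ordered_yao_edges_def by fastforce
    qed
  next
    fix a b assume "(a, b) \<in> ?A \<union> ?B"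
    then show "(a, b) \<in> ?L"
    proof
      assume "(a, b) \<in> ?A"
      then obtain j i where "j < length ps" "a = ps ! j" "i < k"
        "is_arg_min (dist a) (\<lambda>x. x \<in> set (take j ps) \<inter> sector k i a) b"
        unfolding ordered_yao_edges_def by auto
      then show ?thesis unfolding ordered_yao_edges_def using *
        by (intro CollectI exI[of _ j] exI[of _ b]) auto
    next
      assume "(a, b) \<in> ?B"
      then show ?thesis unfolding ordered_yao_edges_def yao_targets_def
        by (intro CollectI exI[of _ "length ps"] exI[of _ b]) auto
    qed
  qed
qed

lemma card_ordered_yao_edges_snoc:
  assumes "distinct (ps @ [p])" "general_position k (set (ps @ [p]))"
  shows "card (ordered_yao_edges k (ps @ [p])) =
    card (ordered_yao_edges k ps) + card (seen_sectors k p (set ps))"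
proof -
  have sub: "ordered_yao_edges k qs \<subseteq> set qs \<times> set qs" for qs
    unfolding ordered_yao_edges_def is_arg_min_def
    by (auto dest: in_set_takeD)
  have fin: "finite (ordered_yao_edges k qs)" for qs
    using finite_subset[OF sub] by blast
  have "card (ordered_yao_edges k (ps @ [p])) =
      card (ordered_yao_edges k ps) + card ({p} \<times> yao_targets k p (set ps))"
    unfolding ordered_yao_edges_snoc
  proof (rule card_Un_disjoint)
    show "finite ({p} \<times> yao_targets k p (set ps))"
      using fin[of "ps @ [p]"] unfolding ordered_yao_edges_snoc by blast
    show "ordered_yao_edges k ps \<inter> {p} \<times> yao_targets k p (set ps) = {}"
      using sub[of ps] assms(1) by auto
  qed (rule fin)
  then show ?thesis
    using card_yao_targets[of k p "set ps"] assms by (simp add: card_cartesian_product_singleton)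
qed

section \<open>Orders with many edges\<close>

text \<open>
  If \<open>x < y < z\<close>, the outer difference is the sum of the inner ones, hence twice it is at least
  \<open>2 * (k - 1)\<close>; being at most \<open>k + 1\<close>, it forces \<open>k \<le> 3\<close>. For \<open>k = 2\<close> the inner differences are at
  least 1 by integrality, which makes the outer one too large.
\<close>

lemma no_three_pairwise_opposite:
  fixes x y z k :: int
  assumes "2 * (x - y) \<in> {k - 1..k + 1} \<or> 2 * (y - x) \<in> {k - 1..k + 1}"
    and "2 * (y - z) \<in> {k - 1..k + 1} \<or> 2 * (z - y) \<in> {k - 1..k + 1}"
    and "2 * (x - z) \<in> {k - 1..k + 1} \<or> 2 * (z - x) \<in> {k - 1..k + 1}"
    and "k \<ge> 2"
  shows "k = 3"
  using assms unfolding atLeastAtMost_iff by (elim disjE conjE) presburger+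

lemma two_sector_point_exists:
  assumes gp: "general_position k Q" and "finite Q" "k \<ge> 2"
    and card: "card Q \<ge> 4 \<or> card Q \<ge> 3 \<and> k \<noteq> 3"
  shows "\<exists>p\<in>Q. card (seen_sectors k p (Q - {p})) \<ge> 2"
proof (rule ccontr)
  assume neg: "\<not> ?thesis"
  have sec: "\<exists>i<k. q \<in> sector k i p" if "p \<in> Q" "q \<in> Q" "q \<noteq> p" for p q
    using in_some_sector[of q p k] that gp \<open>k \<ge> 2\<close> unfolding general_position_def
    by (metis not_numeral_le_zero not_gr_zero)
  have same: "i = j" if "p \<in> Q" "q \<in> Q" "q \<noteq> p" "q' \<in> Q" "q' \<noteq> p"
    "q \<in> sector k i p" "q' \<in> sector k j p" "i < k" "j < k" for p q q' i j
  proof (rule ccontr)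
    assume "i \<noteq> j"
    have "{i, j} \<subseteq> seen_sectors k p (Q - {p})"
      using that by (auto simp: seen_sectors_def)
    from card_mono[OF finite_seen_sectors this] \<open>i \<noteq> j\<close>
    have "card (seen_sectors k p (Q - {p})) \<ge> 2" by simp
    with neg \<open>p \<in> Q\<close> show False by blast
  qed
  have "\<exists>i<k. \<forall>q\<in>Q - {p}. q \<in> sector k i p" if p: "p \<in> Q" for p
  proof -
    have "Q - {p} \<noteq> {}"
      using card p \<open>finite Q\<close> card_mono[of "{p}" Q] by auto
    then obtain q where q: "q \<in> Q" "q \<noteq> p" by auto
    then obtain i where i: "i < k" "q \<in> sector k i p" using sec p by blast
    have "q' \<in> sector k i p" if "q' \<in> Q - {p}" for q'
      using sec[OF p, of q'] same[OF p q, of q' i] i that by blast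
    with i show ?thesis by blast
  qed
  then obtain f where f: "\<And>p. p \<in> Q \<Longrightarrow> f p < k"
    "\<And>p q. p \<in> Q \<Longrightarrow> q \<in> Q \<Longrightarrow> q \<noteq> p \<Longrightarrow> q \<in> sector k (f p) p"
    by (metis Diff_iff empty_iff insert_iff)
  have opp: "2 * (int (f p) - int (f q)) \<in> {int k - 1..int k + 1} \<or>
      2 * (int (f q) - int (f p)) \<in> {int k - 1..int k + 1}" if "p \<in> Q" "q \<in> Q" "p \<noteq> q" for p q
    using opposite_sectors f that by metis
  have "card Q \<ge> 3" using card by auto
  then obtain R where R: "R \<subseteq> Q" "card R = 3"
    by (meson obtain_subset_with_card_n)
  then obtain a b c where abc: "R = {a, b, c}" "a \<noteq> b" "b \<noteq> c" "a \<noteq> c"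
    by (auto simp: card_3_iff)
  with R have Q: "a \<in> Q" "b \<in> Q" "c \<in> Q" by auto
  \<comment> \<open>\<open>f p\<close> is now the only sector that \<open>p\<close> sees, and any two values of \<open>f\<close> are opposite.\<close>
  have "int k = 3"
    using opp[OF Q(1,2) abc(2)] opp[OF Q(2,3) abc(3)] opp[OF Q(1,3) abc(4)] \<open>k \<ge> 2\<close>
      no_three_pairwise_opposite[of "f a" "f b" k "f c"] by simp
  then have k3: "k = 3" by simp
  have "inj_on f Q"
  proof (rule inj_onI, rule ccontr)
    fix p q assume "p \<in> Q" "q \<in> Q" "f p = f q" "p \<noteq> q"
    then show False using opp[of p q] k3 by simp
  qed
  then have "card Q \<le> card {..<k}"
    using f(1) by (intro card_inj_on_le[of f]) auto
  with card k3 show False by simp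
qed

text \<open>
  Greedy construction from the back. While more than \<open>m\<close> points are left, the last one is chosen to
  see two sectors; the final \<open>m\<close> points are ordered arbitrarily and still yield an edge each, except
  for the very first.
\<close>

lemma order_with_many_edges:
  assumes "finite P" "general_position k P" "k > 0" "1 \<le> m" "m \<le> card P"
    and "\<And>Q. Q \<subseteq> P \<Longrightarrow> card Q > m \<Longrightarrow> \<exists>p\<in>Q. card (seen_sectors k p (Q - {p})) \<ge> 2"
  shows "\<exists>ps. distinct ps \<and> set ps = P \<and>
    2 * int (card P) - int m - 1 \<le> int (card (ordered_yao_edges k ps))"
proof -
  \<comment> \<open>the number of edges that the construction guarantees for a subset \<open>Q\<close>\<close>
  define gain where "gain Q = int (card Q) - 1 + (if card Q > m then int (card Q) - int m else 0)"
    for Q :: "(real ^ 2) set"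
  have "\<exists>ps. distinct ps \<and> set ps = Q \<and> gain Q \<le> int (card (ordered_yao_edges k ps))"
    if "Q \<subseteq> P" for Q
    using finite_subset[OF that assms(1)] that
  proof (induction "card Q" arbitrary: Q)
    case 0
    then show ?case using assms by (intro exI[of _ "[]"]) (auto simp: gain_def)
  next
    case (Suc n)
    have gp: "general_position k Q" using general_position_subset Suc.prems(2) assms(2) by blast
    have "\<exists>p\<in>Q. gain Q \<le> gain (Q - {p}) + card (seen_sectors k p (Q - {p}))
        \<or> Q = {p}"
    proof (cases "card Q > m")
      case True
      then obtain p where p: "p \<in> Q" "card (seen_sectors k p (Q - {p})) \<ge> 2"
        using assms(6) Suc.prems by blast
      then have "gain Q \<le> gain (Q - {p}) + card (seen_sectors k p (Q - {p}))"
        using True Suc.prems(1) by (auto simp: gain_def card_Diff_singleton)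
      with p show ?thesis by blast
    next
      case False
      obtain p where p: "p \<in> Q" using Suc.hyps(2) by fastforce
      show ?thesis
      proof (cases "Q = {p}")
        case False
        then obtain q where q: "q \<in> Q" "q \<noteq> p" using p by auto
        obtain i where i: "i < k" "q \<in> sector k i p"
          using in_some_sector[of q p k] q p gp assms(3) unfolding general_position_def by metis
        have "{i} \<subseteq> seen_sectors k p (Q - {p})"
          using i q by (auto simp: seen_sectors_def)
        from card_mono[OF finite_seen_sectors this]
        have "gain Q \<le> gain (Q - {p}) + card (seen_sectors k p (Q - {p}))"
          using \<open>\<not> card Q > m\<close> Suc.prems(1) p by (auto simp: gain_def card_Diff_singleton)
        with p show ?thesis by blast
      qed (use p in blast)
    qed
    then obtain p where p: "p \<in> Q"
      "gain Q \<le> gain (Q - {p}) + card (seen_sectors k p (Q - {p})) \<or> Q = {p}" by blast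
    have "n = card (Q - {p})" using Suc.hyps(2) p(1) Suc.prems(1) by simp
    from Suc.hyps(1)[OF this] Suc.prems obtain ps where
      ps: "distinct ps" "set ps = Q - {p}" "gain (Q - {p}) \<le> int (card (ordered_yao_edges k ps))"
      by auto
    have Q: "set (ps @ [p]) = Q" using ps(2) p(1) by auto
    have d: "distinct (ps @ [p])" using ps by simp
    have "gain Q \<le> int (card (ordered_yao_edges k (ps @ [p])))"
      using p(2)
    proof
      assume "Q = {p}"
      then show ?thesis using assms(4) by (simp add: gain_def)
    next
      assume "gain Q \<le> gain (Q - {p}) + card (seen_sectors k p (Q - {p}))"
      then show ?thesis
        using card_ordered_yao_edges_snoc[OF d] gp Q ps by simp
    qed
    then show ?case using d Q by blast
  qed
  from this[of P] show ?thesis using assms(5) by (fastforce simp: gain_def split: if_splits)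
qed

section \<open>Point sets with few edges in every order\<close>

text \<open>
  Every appended point raises the left-hand side by at most 2: a point of \<open>S\<close> is counted once more
  in the second summand but brings at most one edge. The first point brings no edge at all, which
  gives the \<open>- 1\<close>.
\<close>

lemma edges_bound_by_one_sector_points:
  assumes "general_position k P" "finite P"
    and two: "\<And>p. p \<in> P \<Longrightarrow> card (seen_sectors k p (P - {p})) \<le> 2"
    and one: "\<And>p. p \<in> S \<Longrightarrow> card (seen_sectors k p (P - {p})) \<le> 1"
    and "distinct ps" "set ps \<subseteq> P" "ps \<noteq> []"
  shows "card (ordered_yao_edges k ps) + card (S \<inter> set ps) \<le> 2 * length ps - 1"
  using assms(5-7)
proof (induction ps rule: rev_induct)
  case (snoc p ps)
  have edges: "card (ordered_yao_edges k (ps @ [p])) =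
    card (ordered_yao_edges k ps) + card (seen_sectors k p (set ps))"
    using card_ordered_yao_edges_snoc snoc.prems assms(1) general_position_subset by blast
  have S: "card (S \<inter> set (ps @ [p])) = card (S \<inter> set ps) + (if p \<in> S then 1 else 0)"
    using snoc.prems(1) by (cases "p \<in> S") auto
  show ?case
  proof (cases "ps = []")
    case True
    then show ?thesis using edges S by simp
  next
    case False
    then have IH: "card (ordered_yao_edges k ps) + card (S \<inter> set ps) \<le> 2 * length ps - 1"
      using snoc by simp
    have "seen_sectors k p (set ps) \<subseteq> seen_sectors k p (P - {p})"
      using snoc.prems by (intro seen_sectors_mono) auto
    from card_mono[OF finite_seen_sectors this]
    have "card (seen_sectors k p (set ps)) + (if p \<in> S then 1 else 0) \<le> 2"
      using two[of p] one[of p] snoc.prems(2) by auto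
    moreover have "length ps \<ge> 1" using False by (simp add: Suc_le_eq)
    ultimately show ?thesis using edges S IH by simp
  qed
qed simp

lemma max_yao_edges_eq:
  assumes lower: "\<And>P. finite P \<Longrightarrow> card P = n \<Longrightarrow> general_position k P \<Longrightarrow>
      \<exists>ps. distinct ps \<and> set ps = P \<and> m \<le> int (card (ordered_yao_edges k ps))"
    and P: "finite P" "card P = n" "general_position k P" "n > 0"
    and two: "\<And>p. p \<in> P \<Longrightarrow> card (seen_sectors k p (P - {p})) \<le> 2"
    and one: "\<And>p. p \<in> S \<Longrightarrow> card (seen_sectors k p (P - {p})) \<le> 1"
    and S: "S \<subseteq> P" "m = 2 * int n - 1 - int (card S)"
  shows "max_yao_edges k n = m"
  unfolding max_yao_edges_def
proof (rule Greatest_equality)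
  fix m' assume "\<forall>P. finite P \<and> card P = n \<and> general_position k P \<longrightarrow>
        (\<exists>ps. distinct ps \<and> set ps = P \<and> m' \<le> int (card (ordered_yao_edges k ps)))"
  then obtain ps where ps: "distinct ps" "set ps = P" "m' \<le> int (card (ordered_yao_edges k ps))"
    using P by blast
  have "length ps = n" using ps P distinct_card by fastforce
  moreover have "card (ordered_yao_edges k ps) + card (S \<inter> set ps) \<le> 2 * length ps - 1"
    using \<open>length ps = n\<close> P ps two one by (intro edges_bound_by_one_sector_points) auto
  ultimately show "m' \<le> m"
    using S ps P(4) by (simp add: Int_absorb2)
qed (use lower in blast)

text \<open>
  For a concrete point set it is convenient to name the sector \<open>\<sigma> p q\<close> in which \<open>p\<close> sees \<open>q\<close>: this
  single piece of data settles general position up to ties of distances, and by the next lemma also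
  the seen sectors.
\<close>

lemma general_position_by_sector_map:
  assumes "\<And>p q. p \<in> P \<Longrightarrow> q \<in> P \<Longrightarrow> p \<noteq> q \<Longrightarrow> \<sigma> p q < k \<and> q \<in> sector k (\<sigma> p q) p"
    and "\<And>p q q'. p \<in> P \<Longrightarrow> q \<in> P \<Longrightarrow> q' \<in> P \<Longrightarrow> p \<noteq> q \<Longrightarrow> p \<noteq> q' \<Longrightarrow> q \<noteq> q' \<Longrightarrow>
      \<sigma> p q = \<sigma> p q' \<Longrightarrow> dist p q \<noteq> dist p q'"
  shows "general_position k P"
  unfolding general_position_def
proof (intro conjI ballI allI impI)
  fix p q i assume "p \<in> P" "q \<in> P" "q \<noteq> p" "i < k"
  then show "q \<notin> bounding_ray k i p"
    using assms(1)[of p q] sector_disjoint_bounding_ray by blast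
next
  fix p q q' i assume *: "p \<in> P" "q \<in> P" "q' \<in> P" "p \<noteq> q \<and> p \<noteq> q' \<and> q \<noteq> q'" "i < k"
    "q \<in> sector k i p \<and> q' \<in> sector k i p"
  have "\<sigma> p q = i" "\<sigma> p q' = i"
    using sector_index_unique assms(1) * by metis+
  then show "dist p q \<noteq> dist p q'"
    using assms(2) * by simp
qed

lemma seen_sectors_by_sector_map:
  assumes "\<And>q. q \<in> A \<Longrightarrow> \<sigma> q < k \<and> q \<in> sector k (\<sigma> q) p"
  shows "seen_sectors k p A = \<sigma> ` A"
  unfolding seen_sectors_def using assms sector_index_unique by blast

text \<open>
  Equally spaced points on a line. Its direction is a quarter of the way into sector 0; the opposite
  direction is \<open>1/4 + k/2\<close> in units of one sector, which is never an integer, so no point lies on a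
  ray of another. Equal distances occur only on opposite sides of a point, hence in different sectors.
\<close>

lemma line_witness:
  assumes "k \<ge> 2" "n \<ge> 2"
  obtains P S where "finite P" "card P = n" "general_position k P"
    "\<And>p. p \<in> P \<Longrightarrow> card (seen_sectors k p (P - {p})) \<le> 2"
    "\<And>p. p \<in> S \<Longrightarrow> card (seen_sectors k p (P - {p})) \<le> 1"
    "S \<subseteq> P" "card S = 2"
proof -
  define d where "d = unit_dir (2 * pi * (1/4) / k)"
  define f where "f i = real i *\<^sub>R d" for i
  define P where "P = f ` {..<n}"
  define \<sigma> where "\<sigma> p q = (if p \<bullet> d < q \<bullet> d then 0 else k div 2)" for p q
  have d: "d \<bullet> d = 1" "norm d = 1" by (simp_all add: d_def flip: norm_eq_1)
  have fd: "f i \<bullet> d = i" for i by (simp add: f_def d)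
  have f_eq: "f i = f j \<longleftrightarrow> i = j" for i j
    using fd by (metis of_nat_eq_iff)
  have dist_f: "dist (f i) (f j) = \<bar>real i - real j\<bar>" for i j
    by (simp add: dist_norm f_def d flip: scaleR_left_diff_distrib)
  have fin: "finite P" by (simp add: P_def)
  have card: "card P = n" by (simp add: P_def card_image f_eq inj_on_def)
  have forward: "f j \<in> sector k 0 (f i)" if "i < j" for i j
  proof (rule sectorI)
    show "f j = f i + (real j - real i) *\<^sub>R unit_dir (2 * pi * (1/4) / k)"
      by (simp add: f_def d_def algebra_simps)
  qed (use that assms in auto)
  have backward: "f j \<in> sector k (k div 2) (f i)" if "j < i" for i j
  proof (rule sectorI)
    have "2 * pi * (1/4 + k/2) / k = 2 * pi * (1/4) / k + pi"
      using assms by (simp add: field_simps)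
    then show "f j = f i + (real i - real j) *\<^sub>R unit_dir (2 * pi * (1/4 + k/2) / k)"
      by (simp only: unit_dir_plus_pi) (simp add: f_def d_def algebra_simps)
    have "2 * (k div 2) \<le> k" "k \<le> 2 * (k div 2) + 1" by simp_all
    then have "2 * real (k div 2) \<le> k" "k \<le> 2 * real (k div 2) + 1" by linarith+
    then show "real (k div 2) < 1/4 + k/2" "1/4 + k/2 < real (k div 2) + 1" by linarith+
  qed (use that assms in auto)
  have \<sigma>: "\<sigma> p q < k \<and> q \<in> sector k (\<sigma> p q) p" if "p \<in> P" "q \<in> P" "p \<noteq> q" for p q
    using that assms forward backward by (auto simp: P_def \<sigma>_def fd f_eq)
  have gp: "general_position k P"
  proof (rule general_position_by_sector_map[OF \<sigma>])
    fix p q q' assume *: "p \<in> P" "q \<in> P" "q' \<in> P" "p \<noteq> q" "p \<noteq> q'" "q \<noteq> q'" "\<sigma> p q = \<sigma> p q'"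
    then obtain a b c where "p = f a" "q = f b" "q' = f c" by (auto simp: P_def)
    with * assms show "dist p q \<noteq> dist p q'"
      by (auto simp: \<sigma>_def fd f_eq dist_f split: if_splits)
  qed
  have seen: "seen_sectors k p (P - {p}) = \<sigma> p ` (P - {p})" if "p \<in> P" for p
    using \<sigma> that by (intro seen_sectors_by_sector_map) auto
  show thesis
  proof (rule that[of P "{f 0, f (n - 1)}"])
    fix p assume "p \<in> P"
    have "\<sigma> p ` (P - {p}) \<subseteq> {0, k div 2}" by (auto simp: \<sigma>_def)
    from card_mono[OF _ this] show "card (seen_sectors k p (P - {p})) \<le> 2"
      using seen[OF \<open>p \<in> P\<close>] by (simp add: card_insert_if split: if_splits)
  next
    fix p assume p: "p \<in> {f 0, f (n - 1)}"
    then have "p \<in> P" using assms by (auto simp: P_def)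
    have "\<exists>c. \<sigma> p ` (P - {p}) \<subseteq> {c}"
      using p assms by (auto simp: P_def \<sigma>_def fd f_eq)
    then obtain c where "\<sigma> p ` (P - {p}) \<subseteq> {c}" by blast
    from card_mono[OF _ this] show "card (seen_sectors k p (P - {p})) \<le> 1"
      using seen[OF \<open>p \<in> P\<close>] by simp
  qed (use fin card gp assms in \<open>auto simp: f_eq P_def\<close>)
qed

text \<open>
  For \<open>k \<ge> 3\<close> a sector is a convex cone and is cut out by two half planes: to the left of its first
  bounding ray and to the right of its second one. The two sines in the proof are the cross products
  of the direction with these rays, up to a positive factor.
\<close>

lemma sector_if_between_rays:
  fixes p q :: "real ^ 2" and k i :: nat
  defines "\<alpha> \<equiv> 2 * pi * real i / real k" and "\<beta> \<equiv> 2 * pi * real (Suc i) / real k"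
  assumes "k \<ge> 3" "i < k"
    and left: "cos \<alpha> * (q - p) $ 2 - sin \<alpha> * (q - p) $ 1 > 0"
    and right: "cos \<beta> * (q - p) $ 2 - sin \<beta> * (q - p) $ 1 < 0"
  shows "q \<in> sector k i p"
proof -
  have "q - p \<noteq> 0" using left by auto
  then obtain r t where rt: "r > 0" "0 \<le> t" "t < 2 * pi" "q - p = r *\<^sub>R unit_dir t"
    using polar_form by metis
  have "r * sin (t - \<alpha>) > 0" "r * sin (\<beta> - t) > 0"
    using left right by (simp_all add: rt(4) sin_diff algebra_simps)
  then have s: "sin (t - \<alpha>) > 0" "sin (\<beta> - t) > 0"
    using rt(1) by (simp_all add: zero_less_mult_iff)
  have "\<beta> = \<alpha> + 2 * pi / k" by (simp add: \<alpha>_def \<beta>_def distrib_left add_divide_distrib)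
  moreover have "2 * pi / k < pi" "2 * pi / k > 0" using assms(3) by (simp_all add: field_simps)
  moreover have "0 \<le> \<alpha>" by (simp add: \<alpha>_def)
  moreover have "\<beta> \<le> 2 * pi" using assms(4) mult_left_mono[of "real (Suc i)" "real k" "2 * pi"]
    by (simp add: \<beta>_def divide_le_eq)
  ultimately have b: "0 \<le> \<alpha>" "\<alpha> < \<beta>" "\<beta> < \<alpha> + pi" "\<beta> \<le> 2 * pi" by linarith+
  have "\<alpha> < t"
  proof (rule ccontr)
    assume "\<not> \<alpha> < t"
    have "\<not> \<alpha> - t \<le> pi"
      using sin_ge_zero[of "\<alpha> - t"] s(1) \<open>\<not> \<alpha> < t\<close> sin_minus[of "\<alpha> - t"] by auto
    then have "sin (2 * pi - (\<beta> - t)) \<ge> 0"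
      using b rt(2,3) by (intro sin_ge_zero) linarith+
    then show False using s(2) by (simp add: sin_diff)
  qed
  moreover have "t < \<beta>"
  proof (rule ccontr)
    assume "\<not> t < \<beta>"
    have "\<not> t - \<beta> \<le> pi"
      using sin_ge_zero[of "t - \<beta>"] s(2) \<open>\<not> t < \<beta>\<close> sin_minus[of "t - \<beta>"] by auto
    then have "sin (2 * pi - (t - \<alpha>)) \<ge> 0"
      using b rt(2,3) by (intro sin_ge_zero) linarith+
    then show False using s(1) by (simp add: sin_diff)
  qed
  moreover have "q = p + r *\<^sub>R unit_dir t" using rt(4) by (simp add: algebra_simps)
  ultimately show ?thesis
    unfolding sector_def using rt(1) by (auto simp: \<alpha>_def \<beta>_def)
qed

text \<open>
  The three sectors for \<open>k = 3\<close> in Cartesian coordinates; their bounding rays are the positive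
  \<open>x\<close>-axis and the rays of slope \<open>- sqrt 3\<close> and \<open>sqrt 3\<close> in the left half plane.
\<close>

lemma three_sectors:
  fixes p q :: "real ^ 2"
  defines "x \<equiv> (q - p) $ 1" and "y \<equiv> (q - p) $ 2"
  shows "0 < y \<Longrightarrow> 0 < sqrt 3 * x + y \<Longrightarrow> q \<in> sector 3 0 p"
    and "sqrt 3 * x + y < 0 \<Longrightarrow> sqrt 3 * x - y < 0 \<Longrightarrow> q \<in> sector 3 1 p"
    and "y < 0 \<Longrightarrow> 0 < sqrt 3 * x - y \<Longrightarrow> q \<in> sector 3 2 p"
proof -
  have c: "cos (2 * pi / 3) = - 1/2" "sin (2 * pi / 3) = sqrt 3 / 2"
    using cos_120 sin_120 by simp_all
  have "4 * pi / 3 = 2 * pi - 2 * pi / 3" by simp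
  then have c': "cos (4 * pi / 3) = - 1/2" "sin (4 * pi / 3) = - (sqrt 3 / 2)"
    using c by (simp_all only: cos_diff sin_diff) simp_all
  show "0 < y \<Longrightarrow> 0 < sqrt 3 * x + y \<Longrightarrow> q \<in> sector 3 0 p"
    by (rule sector_if_between_rays[where k = 3 and i = 0 and p = p and q = q, folded x_def y_def])
      (simp_all add: c)
  show "sqrt 3 * x + y < 0 \<Longrightarrow> sqrt 3 * x - y < 0 \<Longrightarrow> q \<in> sector 3 1 p"
    by (rule sector_if_between_rays[where k = 3 and i = 1 and p = p and q = q, folded x_def y_def])
      (simp_all add: c c')
  show "y < 0 \<Longrightarrow> 0 < sqrt 3 * x - y \<Longrightarrow> q \<in> sector 3 2 p"
    by (rule sector_if_between_rays[where k = 3 and i = 2 and p = p and q = q, folded x_def y_def])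
      (simp_all add: c')
qed

text \<open>
  The points \<open>f w\<close> lie on a line of slope \<open>1/10\<close>, so that each of them sees the later ones in sector 0
  and the earlier ones in sector 1. The apex \<open>r\<close> lies perpendicularly above the first point \<open>f 0\<close>,
  at such a height that \<open>f 0\<close> sees it in sector 0 while all points with parameter in \<open>[1, 2)\<close> see it
  in sector 1; these parameters are bounded away from 0 in order to stay beyond the ray that separates
  the two sectors. The apex itself looks down at all other points in sector 2. So \<open>r\<close> and the two ends of the
  line see one sector each. As the apex is at least as far from every point of the line as twice the
  parameter unit, it is farther away than the rest of the line, and its distances to the points of the line
  increase with the parameter; hence no distances tie within a sector.
\<close>

lemma triangle_witness:
  assumes "n \<ge> 3"
  obtains P S where "finite P" "card P = n" "general_position 3 P"
    "\<And>p. p \<in> P \<Longrightarrow> card (seen_sectors 3 p (P - {p})) \<le> 2"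
    "\<And>p. p \<in> S \<Longrightarrow> card (seen_sectors 3 p (P - {p})) \<le> 1"
    "S \<subseteq> P" "card S = 3"
proof -
  obtain V :: "real set" where V: "finite V" "card V = n - 2" "V \<subseteq> {1..<2}"
    using infinite_arbitrarily_large[of "{1..<2::real}" "n - 2"] by auto
  define W where "W = insert 0 V"
  define f :: "real \<Rightarrow> real ^ 2" where "f w = vector [10 * w, w]" for w
  define r :: "real ^ 2" where "r = vector [-2, 20]"
  define P where "P = insert r (f ` W)"
  define \<sigma> where "\<sigma> p q = (if p = r then 2 else if q = r then (if p = f 0 then 0 else 1)
      else if p $ 1 < q $ 1 then 0 else 1 :: nat)" for p q :: "real ^ 2"
  have nth [simp]: "f w $ 1 = 10 * w" "f w $ 2 = w" "r $ 1 = -2" "r $ 2 = 20" for w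
    by (simp_all add: f_def r_def)
  have W: "finite W" "card W = n - 1" "0 \<in> W" "\<And>w. w \<in> W \<Longrightarrow> w = 0 \<or> 1 \<le> w \<and> w < 2"
  proof -
    have "0 \<notin> V" using V(3) by auto
    then show "card W = n - 1" using V assms by (simp add: W_def)
  qed (use V in \<open>auto simp: W_def\<close>)
  have f_eq [simp]: "f v = f w \<longleftrightarrow> v = w" for v w
    by (simp add: vec_eq_iff forall_2)
  have r_neq: "f w \<noteq> r" "r \<noteq> f w" if "w \<in> W" for w
    using W(4)[OF that] by (auto simp: vec_eq_iff forall_2)
  have fin: "finite P" using W by (simp add: P_def)
  have card: "card P = n"
    using W r_neq assms by (auto simp: P_def card_insert_if card_image inj_on_def)
  have rt: "1.7 < sqrt 3" "sqrt 3 < 2"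
    by (rule real_less_rsqrt real_less_lsqrt; simp add: power2_eq_square)+
  have \<sigma>: "\<sigma> p q < 3 \<and> q \<in> sector 3 (\<sigma> p q) p" if "p \<in> P" "q \<in> P" "p \<noteq> q" for p q
  proof -
    have up: "f w \<in> sector 3 0 (f v)" if "v < w" for v w
    proof (rule three_sectors(1))
      show "0 < (f w - f v) $ 2" using that by simp
      show "0 < sqrt 3 * (f w - f v) $ 1 + (f w - f v) $ 2"
        using that by (intro add_nonneg_pos mult_nonneg_nonneg) simp_all
    qed
    have down: "f v \<in> sector 3 1 (f w)" if "v < w" for v w
    proof (rule three_sectors(2))
      have "sqrt 3 * (10 * (w - v)) > 1.7 * (10 * (w - v))"
        using that rt by (intro mult_strict_right_mono) auto
      then show "sqrt 3 * (f v - f w) $ 1 + (f v - f w) $ 2 < 0"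
        "sqrt 3 * (f v - f w) $ 1 - (f v - f w) $ 2 < 0"
        using that by (simp_all add: algebra_simps)
    qed
    have apex: "r \<in> sector 3 (if v = 0 then 0 else 1) (f v)" "f v \<in> sector 3 2 r" if "v \<in> W" for v
    proof -
      have "v \<ge> 0" using W(4)[OF that] by auto
      then have "1.7 * v \<le> sqrt 3 * v" using rt by (intro mult_right_mono) simp_all
      then have *: "sqrt 3 * (10 * v + 2) \<ge> 17 * v + 3.4" "sqrt 3 * (- 2 - 10 * v) \<le> - 17 * v - 3.4"
        using rt by (simp_all add: distrib_left right_diff_distrib)
      have "r \<in> sector 3 0 (f 0)"
        using rt by (intro three_sectors(1)) simp_all
      moreover have "r \<in> sector 3 1 (f v)" if "1 \<le> v" "v < 2"
      proof (rule three_sectors(2))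
        show "sqrt 3 * (r - f v) $ 1 + (r - f v) $ 2 < 0" "sqrt 3 * (r - f v) $ 1 - (r - f v) $ 2 < 0"
          using *(2) that unfolding vector_minus_component nth by linarith+
      qed
      ultimately show "r \<in> sector 3 (if v = 0 then 0 else 1) (f v)"
        using W(4)[OF that] by auto
      show "f v \<in> sector 3 2 r"
      proof (rule three_sectors(3))
        show "(f v - r) $ 2 < 0" "0 < sqrt 3 * (f v - r) $ 1 - (f v - r) $ 2"
          using *(1) W(4)[OF that] unfolding vector_minus_component nth by auto
      qed
    qed
    consider (line) v w where "p = f v" "q = f w" "v \<in> W" "w \<in> W" "v \<noteq> w"
      | (to_apex) v where "p = f v" "q = r" "v \<in> W" | (from_apex) v where "p = r" "q = f v" "v \<in> W"
      using \<open>p \<in> P\<close> \<open>q \<in> P\<close> \<open>p \<noteq> q\<close> by (auto simp: P_def)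
    then show ?thesis
    proof cases
      case line
      then show ?thesis using up[of v w] down[of w v] by (simp add: \<sigma>_def r_neq)
    next
      case to_apex
      then show ?thesis using apex(1)[of v] by (simp add: \<sigma>_def r_neq split: if_splits)
    next
      case from_apex
      then show ?thesis using apex(2)[of v] by (simp add: \<sigma>_def)
    qed
  qed
  have dist_f: "dist (f v) (f w) = sqrt 101 * \<bar>v - w\<bar>" for v w
  proof -
    have "dist (f v) (f w) ^ 2 = (sqrt 101 * \<bar>v - w\<bar>) ^ 2"
      unfolding dist_norm power2_norm_eq_inner inner_vec_def sum_2
      by (simp add: power_mult_distrib) (simp add: power2_eq_square algebra_simps)
    then show ?thesis by (rule power2_eq_imp_eq) auto
  qed
  have dist_r: "dist (f v) r = sqrt 101 * sqrt (4 + v^2)" "dist r (f v) = sqrt 101 * sqrt (4 + v^2)" for v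
  proof -
    have "dist (f v) r ^ 2 = (sqrt 101 * sqrt (4 + v^2)) ^ 2"
      unfolding dist_norm power2_norm_eq_inner inner_vec_def sum_2
      by (simp add: power_mult_distrib) (simp add: power2_eq_square algebra_simps)
    then show "dist (f v) r = sqrt 101 * sqrt (4 + v^2)" by (rule power2_eq_imp_eq) auto
    then show "dist r (f v) = sqrt 101 * sqrt (4 + v^2)" by (simp add: dist_commute)
  qed
  have far: "\<bar>v - w\<bar> < sqrt (4 + v^2)" if "v \<in> W" "w \<in> W" for v w
  proof -
    have "\<bar>v - w\<bar> < 2" using W(4)[OF that(1)] W(4)[OF that(2)] by auto
    also have "2 \<le> sqrt (4 + v^2)" by (rule real_le_rsqrt) simp
    finally show ?thesis .
  qed
  have gp: "general_position 3 P"
  proof (rule general_position_by_sector_map[OF \<sigma>])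
    fix p q q' assume *: "p \<in> P" "q \<in> P" "q' \<in> P" "p \<noteq> q" "p \<noteq> q'" "q \<noteq> q'" "\<sigma> p q = \<sigma> p q'"
    show "dist p q \<noteq> dist p q'"
    proof (cases "p = r")
      case True
      with * obtain v w where vw: "q = f v" "q' = f w" "v \<in> W" "w \<in> W" "v \<noteq> w"
        by (auto simp: P_def)
      have "v^2 \<noteq> w^2" using vw W(4)[of v] W(4)[of w] by (subst power2_eq_iff_nonneg) auto
      then show ?thesis using True vw by (simp add: dist_r)
    next
      case False
      then obtain u where u: "p = f u" "u \<in> W" using * by (auto simp: P_def)
      have apex: "dist p z \<noteq> dist p r" if z: "z \<in> f ` W" for z
      proof -
        obtain w where w: "z = f w" "w \<in> W" using z by blast
        show ?thesis using far[OF u(2) w(2)] by (simp add: u w dist_f dist_r)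
      qed
      show ?thesis
      proof (cases "q = r \<or> q' = r")
        case True
        then show ?thesis using *(2,3,6) apex[of q] apex[of q'] unfolding P_def by (metis insert_iff)
      next
        case False
        then obtain v w where vw: "q = f v" "q' = f w" "v \<in> W" "w \<in> W"
          using *(2,3) unfolding P_def by blast
        with u * have "u \<noteq> v" "u \<noteq> w" "v \<noteq> w" "u < v \<longleftrightarrow> u < w"
          by (auto simp: \<sigma>_def r_neq split: if_splits)
        then show ?thesis by (auto simp: u vw dist_f)
      qed
    qed
  qed
  have seen: "seen_sectors 3 p (P - {p}) = \<sigma> p ` (P - {p})" if "p \<in> P" for p
    using \<sigma> that by (intro seen_sectors_by_sector_map) auto
  \<comment> \<open>the far end of the line\<close>
  define m where "m = Max W"
  have m: "m \<in> W" "\<And>w. w \<in> W \<Longrightarrow> w \<le> m" unfolding m_def using W(1,3) by (auto intro!: Max_in)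
  have "V \<noteq> {}" using V assms by auto
  then obtain v where "v \<in> V" by auto
  then have "m \<ge> 1" using m(2)[of v] V(3) by (auto simp: W_def)
  show thesis
  proof (rule that[of P "{r, f 0, f m}"])
    fix p assume "p \<in> P"
    have "\<sigma> p ` (P - {p}) \<subseteq> {if p = r then 2 else 0, if p = r then 2 else 1}"
      by (auto simp: \<sigma>_def)
    from card_mono[OF _ this] show "card (seen_sectors 3 p (P - {p})) \<le> 2"
      unfolding seen[OF \<open>p \<in> P\<close>] by (cases "p = r") simp_all
  next
    fix p assume p: "p \<in> {r, f 0, f m}"
    then have "p \<in> P" using W(3) m(1) by (auto simp: P_def)
    have "\<sigma> p q = (if p = r then 2 else if p = f 0 then 0 else 1)" if "q \<in> P - {p}" for q
    proof (cases "p = r")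
      case False
      then have p: "p = f 0 \<or> p = f m" using p by auto
      show ?thesis
      proof (cases "q = r")
        case True
        then show ?thesis using False by (simp add: \<sigma>_def)
      next
        case q: False
        then obtain w where w: "q = f w" "w \<in> W" using \<open>q \<in> P - {p}\<close> by (auto simp: P_def)
        have "w > 0" if "p = f 0" using W(4)[OF w(2)] \<open>q \<in> P - {p}\<close> that w by auto
        then show ?thesis using p q False w m(2)[OF w(2)] \<open>m \<ge> 1\<close> by (auto simp: \<sigma>_def)
      qed
    qed (simp add: \<sigma>_def)
    then have "\<sigma> p ` (P - {p}) \<subseteq> {if p = r then 2 else if p = f 0 then 0 else 1}" by blast
    from card_mono[OF _ this] show "card (seen_sectors 3 p (P - {p})) \<le> 1"
      using seen[OF \<open>p \<in> P\<close>] by simp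
  next
    show "card {r, f 0, f m} = 3" using r_neq W(3) m(1) \<open>m \<ge> 1\<close> by simp
  qed (use fin card gp W(3) m(1) in \<open>auto simp: P_def\<close>)
qed

section \<open>The extremal edge numbers\<close>

theorem theorem2:
  shows "(\<forall>k n :: nat. k \<ge> 2 \<and> k \<noteq> 3 \<and> n \<ge> 3 \<longrightarrow> max_yao_edges k n = 2 * int n - 3) \<and>
         (\<forall>n :: nat. n \<ge> 4 \<longrightarrow> max_yao_edges 3 n = 2 * int n - 4)"
proof (intro conjI allI impI)
  fix k n :: nat assume kn: "k \<ge> 2 \<and> k \<noteq> 3 \<and> n \<ge> 3"
  obtain P S where PS: "finite P" "card P = n" "general_position k P"
    "\<And>p. p \<in> P \<Longrightarrow> card (seen_sectors k p (P - {p})) \<le> 2"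
    "\<And>p. p \<in> S \<Longrightarrow> card (seen_sectors k p (P - {p})) \<le> 1"
    "S \<subseteq> P" "card S = 2"
    by (rule line_witness[of k n]) (use kn in simp, use kn in simp, rule that)
  show "max_yao_edges k n = 2 * int n - 3"
  proof (rule max_yao_edges_eq[OF _ PS(1-3) _ PS(4-6)])
    fix Q assume Q: "finite Q" "card Q = n" "general_position k Q"
    have "\<exists>p\<in>R. card (seen_sectors k p (R - {p})) \<ge> 2" if "R \<subseteq> Q" "card R > 2" for R
      using two_sector_point_exists[of k R] general_position_subset[OF Q(3) that(1)]
        finite_subset[OF that(1) Q(1)] that kn by auto
    from order_with_many_edges[where m = 2, OF Q(1,3) _ _ _ this]
    show "\<exists>ps. distinct ps \<and> set ps = Q \<and> 2 * int n - 3 \<le> int (card (ordered_yao_edges k ps))"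
      using kn Q(2) by simp
  qed (use kn PS(7) in auto)
next
  fix n :: nat assume n: "n \<ge> 4"
  obtain P S where PS: "finite P" "card P = n" "general_position 3 P"
    "\<And>p. p \<in> P \<Longrightarrow> card (seen_sectors 3 p (P - {p})) \<le> 2"
    "\<And>p. p \<in> S \<Longrightarrow> card (seen_sectors 3 p (P - {p})) \<le> 1"
    "S \<subseteq> P" "card S = 3"
    by (rule triangle_witness[of n]) (use n in simp, rule that)
  show "max_yao_edges 3 n = 2 * int n - 4"
  proof (rule max_yao_edges_eq[OF _ PS(1-3) _ PS(4-6)])
    fix Q assume Q: "finite Q" "card Q = n" "general_position 3 Q"
    have "\<exists>p\<in>R. card (seen_sectors 3 p (R - {p})) \<ge> 2" if "R \<subseteq> Q" "card R > 3" for R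
      using two_sector_point_exists[of 3 R] general_position_subset[OF Q(3) that(1)]
        finite_subset[OF that(1) Q(1)] that by auto
    from order_with_many_edges[where m = 3, OF Q(1,3) _ _ _ this]
    show "\<exists>ps. distinct ps \<and> set ps = Q \<and> 2 * int n - 4 \<le> int (card (ordered_yao_edges 3 ps))"
      using n Q(2) by simp
  qed (use n PS(7) in auto)
qed

end
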